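(* Let $I\subset\mathbb{R}$ be an interval, let $f:I\to\mathbb{R}$ be differentiable on the interior $I^{\circ}$ with $f'\in L[a,b]$, where $a,b\in I^{\circ}$, $a<b$, and let $\alpha,\lambda\in[0,1]$. If $|f'|^{q}$ is quasi-convex on $[a,b]$ for some $q\ge 1$, then $$\left|\lambda\left(\alpha f(a)+(1-\alpha)f(b)\right)+(1-\lambda)f(\alpha a+(1-\alpha)b)-\frac{1}{b-a}\int_a^b f(x)\,dx\right|$$ $$\le\begin{cases}(b-a)(\gamma_2+\upsilon_2)A^{1/q}, & \alpha\lambda\le 1-\alpha\le 1-\lambda(1-\alpha),\\ (b-a)(\gamma_2+\upsilon_1)A^{1/q}, & \alpha\lambda\le 1-\lambda(1-\alpha)\le 1-\alpha,\\ (b-a)(\gamma_1+\upsilon_2)A^{1/q}, & 1-\alpha\le\alpha\lambda\le 1-\lambda(1-\alpha),\end{cases}$$ where $$\gamma_1=(1-\alpha)\left[\alpha\lambda-\frac{1-\alpha}{2}\right],\qquad \gamma_2=(\alpha\lambda)^2-\gamma_1,$$ $$\upsilon_1=\frac{1-(1-\alpha)^2}{2}-\alpha\left[1-\lambda(1-\alpha)\right],\qquad \upsilon_2=\frac{1+(1-\alpha)^2}{2}-(\lambda+1)(1-\alpha)\left[1-\lambda(1-\alpha)\right],$$ and $A=\sup\{|f'(a)|^q,|f'(b)|^q\}$.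
   Context: A function $g:[a,b]\to\mathbb{R}$ is quasi-convex on $[a,b]$ if $g(tx+(1-t)y)\le\sup\{g(x),g(y)\}$ for all $x,y\in[a,b]$ and $t\in[0,1]$. $L[a,b]$ denotes the set of Lebesgue integrable functions on $[a,b]$. *)

theory Defs
  imports "HOL-Analysis.Analysis"
begin

definition quasiconvex_on :: "real set \<Rightarrow> (real \<Rightarrow> real) \<Rightarrow> bool" where
  "quasiconvex_on S g \<longleftrightarrow>
     (\<forall>x\<in>S. \<forall>y\<in>S. \<forall>t\<in>{0..1}. g (t * x + (1 - t) * y) \<le> max (g x) (g y))"

(* Depending on the case, gamma1 or gamma2 is the integral of |t - alpha * lam| over
   [0, 1 - alpha], and upsilon1 or upsilon2 that of |t - (1 - lam * (1 - alpha))|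
   over [1 - alpha, 1]. *)

definition gamma1 :: "real \<Rightarrow> real \<Rightarrow> real" where
  "gamma1 \<alpha> lam = (1 - \<alpha>) * (\<alpha> * lam - (1 - \<alpha>) / 2)"

definition gamma2 :: "real \<Rightarrow> real \<Rightarrow> real" where
  "gamma2 \<alpha> lam = (\<alpha> * lam)\<^sup>2 - gamma1 \<alpha> lam"

definition upsilon1 :: "real \<Rightarrow> real \<Rightarrow> real" where
  "upsilon1 \<alpha> lam = (1 - (1 - \<alpha>)\<^sup>2) / 2 - \<alpha> * (1 - lam * (1 - \<alpha>))"

definition upsilon2 :: "real \<Rightarrow> real \<Rightarrow> real" where
  "upsilon2 \<alpha> lam =
     (1 + (1 - \<alpha>)\<^sup>2) / 2 - (lam + 1) * (1 - \<alpha>) * (1 - lam * (1 - \<alpha>))"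

end

theory Submission
  imports Defs
begin

text \<open>Quasi-convexity bounds \<open>\<bar>f'\<bar>\<close> on \<open>[a, b]\<close> by \<open>M = A\<^sup>1\<^sup>/\<^sup>q\<close>. With
  \<open>p = \<alpha>a + (1 - \<alpha>)b\<close>, integrating by parts against the kernels \<open>x - u\<close> on \<open>[a, p]\<close> and
  \<open>x - v\<close> on \<open>[p, b]\<close>, where \<open>u = a + \<alpha>\<lambda>(b - a)\<close> and \<open>v = a + (1 - \<lambda>(1 - \<alpha>))(b - a)\<close>, represents
  the left-hand side times \<open>b - a\<close>. The bound is then \<open>M\<close> times the integrals
  of \<open>\<bar>x - u\<bar>\<close> and \<open>\<bar>x - v\<bar>\<close>, whose closed forms depend on the position of \<open>u\<close> and \<open>v\<close>
  relative to \<open>p\<close>.\<close>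

text \<open>An antiderivative is \<open>(x - u) * \<bar>x - u\<bar> / 2\<close>, a single formula
  wherever \<open>u\<close> lies relative to \<open>a\<close> and \<open>b\<close>. The sign
  distinctions are thus postponed to the closed forms at the very end.\<close>

lemma has_integral_abs_diff:
  fixes a b u :: real
  assumes "a \<le> b"
  shows "((\<lambda>x. \<bar>x - u\<bar>) has_integral ((b - u) * \<bar>b - u\<bar> - (a - u) * \<bar>a - u\<bar>) / 2) {a..b}"
proof -
  have deriv: "((\<lambda>x. (x - u) * \<bar>x - u\<bar> / 2) has_vector_derivative \<bar>t - u\<bar>) (at t)"
    if "t \<noteq> u" for t
  proof -
    have smooth: "((\<lambda>x. (x - u) * (sgn (t - u) * (x - u)) / 2) has_field_derivative \<bar>t - u\<bar>) (at t)"
      by (auto intro!: derivative_eq_intros simp: abs_sgn mult.commute)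
    \<comment> \<open>Near \<open>t \<noteq> u\<close> the sign of \<open>x - u\<close> is constant,
      so the antiderivative agrees locally with the polynomial in \<open>smooth\<close>.\<close>
    have "\<forall>\<^sub>F x in nhds t. sgn (x - u) = sgn (t - u)"
    proof (cases "u < t")
      case True
      then show ?thesis
        by (auto intro: eventually_mono[OF eventually_nhds_in_open[of "{u<..}"]])
    next
      case False
      with that show ?thesis
        by (auto intro: eventually_mono[OF eventually_nhds_in_open[of "{..<u}"]])
    qed
    then have eq: "\<forall>\<^sub>F x in nhds t. (x - u) * \<bar>x - u\<bar> / 2 = (x - u) * (sgn (t - u) * (x - u)) / 2"
      by eventually_elim (simp add: abs_sgn mult.commute)
    show ?thesis
      unfolding has_real_derivative_iff_has_vector_derivative[symmetric]
      by (rule iffD2[OF DERIV_cong_ev[OF refl eq refl] smooth])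
  qed
  have "((\<lambda>x. \<bar>x - u\<bar>) has_integral
      (b - u) * \<bar>b - u\<bar> / 2 - (a - u) * \<bar>a - u\<bar> / 2) {a..b}"
    \<comment> \<open>At the exceptional point \<open>u\<close>, continuity of the antiderivative is
      enough.\<close>
    by (rule fundamental_theorem_of_calculus_strong[where S = "{u}"])
      (use assms deriv in \<open>auto intro!: continuous_intros\<close>)
  then show ?thesis
    by (simp add: diff_divide_distrib)
qed

text \<open>Integration by parts: the left-hand side is the absolute value of the integral of
  \<open>(x - u) * f' x\<close>, whose integrand is dominated by
  \<open>M * \<bar>x - u\<bar>\<close>. The zero \<open>u\<close> of the kernel is free and sets the
  weights of the two endpoint values.\<close>

lemma integral_kernel_bound:
  fixes f f' :: "real \<Rightarrow> real" and a b u M :: real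
  assumes "a \<le> b"
    and deriv: "\<And>x. x \<in> {a..b} \<Longrightarrow> (f has_field_derivative f' x) (at x)"
    and bound: "\<And>x. x \<in> {a..b} \<Longrightarrow> \<bar>f' x\<bar> \<le> M"
  shows "\<bar>(b - u) * f b - (a - u) * f a - integral {a..b} f\<bar>
    \<le> M * (((b - u) * \<bar>b - u\<bar> - (a - u) * \<bar>a - u\<bar>) / 2)"
proof -
  have cont: "continuous_on {a..b} f"
    by (meson deriv DERIV_isCont continuous_at_imp_continuous_on)
  have "((\<lambda>x. (x - u) * f' x + f x) has_integral ((b - u) * f b - (a - u) * f a)) {a..b}"
  proof (rule fundamental_theorem_of_calculus[OF \<open>a \<le> b\<close>])
    fix x assume "x \<in> {a..b}"
    then have "((\<lambda>x. (x - u) * f x) has_field_derivative (x - u) * f' x + f x) (at x)"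
      by (auto intro!: derivative_eq_intros deriv)
    then show "((\<lambda>x. (x - u) * f x) has_vector_derivative (x - u) * f' x + f x) (at x within {a..b})"
      by (simp add: has_real_derivative_iff_has_vector_derivative has_vector_derivative_at_within)
  qed
  from has_integral_diff[OF this integrable_integral[OF integrable_continuous_interval[OF cont]]]
  have by_parts: "((\<lambda>x. (x - u) * f' x) has_integral
      ((b - u) * f b - (a - u) * f a - integral {a..b} f)) {a..b}"
    by simp
  note kernel = has_integral_mult_right[OF has_integral_abs_diff[OF \<open>a \<le> b\<close>], of M u]
  have "norm (integral {a..b} (\<lambda>x. (x - u) * f' x)) \<le> integral {a..b} (\<lambda>x. M * \<bar>x - u\<bar>)"
  proof (rule integral_norm_bound_integral)
    show "norm ((x - u) * f' x) \<le> M * \<bar>x - u\<bar>" if "x \<in> {a..b}" for x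
      using mult_right_mono[OF bound[OF that], of "\<bar>x - u\<bar>"] by (simp add: abs_mult mult.commute)
  qed (use by_parts kernel in \<open>auto dest: has_integral_integrable\<close>)
  then show ?thesis
    unfolding integral_unique[OF by_parts] integral_unique[OF kernel] real_norm_def .
qed

lemma quasiconvex_on_atLeastAtMost_le:
  fixes g :: "real \<Rightarrow> real"
  assumes "quasiconvex_on {a..b} g" and "x \<in> {a..b}"
  shows "g x \<le> max (g a) (g b)"
proof -
  have "a \<le> b" using assms(2) by simp
  then obtain t where "t \<in> {0..1}" and "x = t * a + (1 - t) * b"
    using assms(2) closed_segment_eq_real_ivl[of b a] closed_segment_eq_real_ivl[of a b]
    unfolding closed_segment_def
    by (smt (verit, best) atLeastAtMost_iff mem_Collect_eq real_scaleR_def)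
  then show ?thesis
    using assms(1) \<open>a \<le> b\<close> unfolding quasiconvex_on_def by auto
qed

lemma le_powr_inverse:
  fixes x q A :: real
  assumes "0 \<le> x" and "0 < q" and "x powr q \<le> A"
  shows "x \<le> A powr (1 / q)"
proof -
  have "x = (x powr q) powr (1 / q)"
    using assms by (simp add: powr_powr)
  also have "\<dots> \<le> A powr (1 / q)"
    using assms by (intro powr_mono2) auto
  finally show ?thesis .
qed

theorem theorem5:
  fixes f :: "real \<Rightarrow> real" and I :: "real set" and a b \<alpha> lam q A E :: real
  assumes "is_interval I"
    and "\<forall>x\<in>interior I. f differentiable (at x)"
    and "a \<in> interior I" and "b \<in> interior I" and "a < b"
    and "deriv f absolutely_integrable_on {a..b}"
    and "\<alpha> \<in> {0..1}" and "lam \<in> {0..1}"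
    and "q \<ge> 1"
    and "quasiconvex_on {a..b} (\<lambda>x. \<bar>deriv f x\<bar> powr q)"
  defines "A \<equiv> max (\<bar>deriv f a\<bar> powr q) (\<bar>deriv f b\<bar> powr q)"
    and "E \<equiv> \<bar>lam * (\<alpha> * f a + (1 - \<alpha>) * f b) + (1 - lam) * f (\<alpha> * a + (1 - \<alpha>) * b)
               - 1 / (b - a) * (LINT x:{a..b}|lebesgue. f x)\<bar>"
  shows "(\<alpha> * lam \<le> 1 - \<alpha> \<and> 1 - \<alpha> \<le> 1 - lam * (1 - \<alpha>) \<longrightarrow>
            E \<le> (b - a) * (gamma2 \<alpha> lam + upsilon2 \<alpha> lam) * A powr (1 / q)) \<and>
         (\<alpha> * lam \<le> 1 - lam * (1 - \<alpha>) \<and> 1 - lam * (1 - \<alpha>) \<le> 1 - \<alpha> \<longrightarrow>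
            E \<le> (b - a) * (gamma2 \<alpha> lam + upsilon1 \<alpha> lam) * A powr (1 / q)) \<and>
         (1 - \<alpha> \<le> \<alpha> * lam \<and> \<alpha> * lam \<le> 1 - lam * (1 - \<alpha>) \<longrightarrow>
            E \<le> (b - a) * (gamma1 \<alpha> lam + upsilon2 \<alpha> lam) * A powr (1 / q))"
proof -
  have sub: "{a..b} \<subseteq> interior I"
  proof -
    have "convex (interior I)"
      using \<open>is_interval I\<close> by (simp add: convex_interior is_interval_convex)
    then show ?thesis
      using \<open>a \<in> interior I\<close> \<open>b \<in> interior I\<close> \<open>a < b\<close>
      by (metis closed_segment_eq_real_ivl convex_contains_segment less_imp_le)
  qed
  have deriv: "(f has_field_derivative deriv f x) (at x)" if "x \<in> {a..b}" for x
    using assms(2) sub that DERIV_deriv_iff_real_differentiable by blast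
  define M where "M = A powr (1 / q)"
  have bound: "\<bar>deriv f x\<bar> \<le> M" if "x \<in> {a..b}" for x
    unfolding M_def using quasiconvex_on_atLeastAtMost_le[OF assms(10) that] \<open>q \<ge> 1\<close>
    by (intro le_powr_inverse) (auto simp: A_def)
  have cont: "continuous_on {a..b} f"
    by (meson deriv DERIV_isCont continuous_at_imp_continuous_on)
  \<comment> \<open>Continuity of \<open>f\<close> on the compact interval identifies the Lebesgue
    integral in \<open>E\<close> with the gauge integral used below.\<close>
  have lint: "(LINT x:{a..b}|lebesgue. f x) = integral {a..b} f"
    by (intro set_lebesgue_integral_eq_integral(2) absolutely_integrable_continuous_real cont)
  \<comment> \<open>Rescale by \<open>x = a + t * d\<close> with \<open>t\<close> in
    \<open>[0, 1]\<close>: \<open>s\<close> is the position of \<open>p\<close>, while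
    \<open>k\<close> and \<open>c\<close> are the zeros of the left and right kernels.\<close>
  define d s k c p where "d = b - a" and "s = 1 - \<alpha>" and "k = \<alpha> * lam"
    and "c = 1 - lam * (1 - \<alpha>)" and "p = a + s * d"
  have d: "d > 0" and b: "b = a + d"
    using \<open>a < b\<close> by (auto simp: d_def)
  \<comment> \<open>The signs of \<open>k\<close> and \<open>1 - c\<close> settle the kernels at the
    outer endpoints; only the signs of \<open>s - k\<close> and \<open>s - c\<close> at
    \<open>p\<close> stay open.\<close>
  have s: "0 \<le> s" "s \<le> 1" and k: "0 \<le> k" and c: "c \<le> 1"
    using assms(7,8) by (auto simp: s_def k_def c_def)
  have ap: "a \<le> p" and pb: "p \<le> b"
    using s d mult_right_mono[of s 1 d] by (auto simp: p_def b)
  have p: "\<alpha> * a + (1 - \<alpha>) * b = p"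
    by (simp add: p_def s_def b algebra_simps)
  \<comment> \<open>The weights in \<open>E\<close> are \<open>lam * \<alpha> = k\<close>,
    \<open>lam * (1 - \<alpha>) = 1 - c\<close> and \<open>1 - lam = c - k\<close>.\<close>
  have E: "E * d = \<bar>k * d * f a + (1 - c) * d * f b + (c - k) * d * f p - integral {a..b} f\<bar>"
  proof -
    have "E * d = \<bar>(lam * (\<alpha> * f a + (1 - \<alpha>) * f b) + (1 - lam) * f p
        - 1 / d * integral {a..b} f) * d\<bar>"
      unfolding E_def lint p d_def[symmetric] using d by (simp add: abs_mult)
    also have "(lam * (\<alpha> * f a + (1 - \<alpha>) * f b) + (1 - lam) * f p - 1 / d * integral {a..b} f) * d
      = k * d * f a + (1 - c) * d * f b + (c - k) * d * f p - integral {a..b} f"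
      using d by (simp add: k_def c_def field_simps)
    finally show ?thesis .
  qed
  have split: "integral {a..b} f = integral {a..p} f + integral {p..b} f"
    using Henstock_Kurzweil_Integration.integral_combine[OF ap pb integrable_continuous_interval[OF cont]]
    by simp
  have left: "\<bar>(s - k) * d * f p + k * d * f a - integral {a..p} f\<bar>
      \<le> M * (d\<^sup>2 * (((s - k) * \<bar>s - k\<bar> + k\<^sup>2) / 2))"
  proof -
    have eqs: "p - (a + k * d) = (s - k) * d" "a - (a + k * d) = - (k * d)"
      by (auto simp: p_def algebra_simps)
    have abs: "\<bar>(s - k) * d\<bar> = \<bar>s - k\<bar> * d" "\<bar>- (k * d)\<bar> = k * d"
      using d k by (simp_all add: abs_mult)
    have "\<bar>(s - k) * d * f p - - (k * d) * f a - integral {a..p} f\<bar>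
        \<le> M * (((s - k) * d * (\<bar>s - k\<bar> * d) - - (k * d) * (k * d)) / 2)"
      using integral_kernel_bound[OF ap, of f "deriv f" M "a + k * d"] deriv bound pb
      unfolding eqs abs by auto
    also have "(s - k) * d * (\<bar>s - k\<bar> * d) - - (k * d) * (k * d)
        = d\<^sup>2 * ((s - k) * \<bar>s - k\<bar> + k\<^sup>2)"
      by (simp add: power2_eq_square algebra_simps)
    finally show ?thesis by simp
  qed
  have right: "\<bar>(1 - c) * d * f b + (c - s) * d * f p - integral {p..b} f\<bar>
      \<le> M * (d\<^sup>2 * (((1 - c)\<^sup>2 - (s - c) * \<bar>s - c\<bar>) / 2))"
  proof -
    have eqs: "b - (a + c * d) = (1 - c) * d" "p - (a + c * d) = (s - c) * d"
      by (auto simp: p_def b algebra_simps)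
    have abs: "\<bar>(1 - c) * d\<bar> = (1 - c) * d" "\<bar>(s - c) * d\<bar> = \<bar>s - c\<bar> * d"
      using d c by (simp_all add: abs_mult)
    have "\<bar>(1 - c) * d * f b - (s - c) * d * f p - integral {p..b} f\<bar>
        \<le> M * (((1 - c) * d * ((1 - c) * d) - (s - c) * d * (\<bar>s - c\<bar> * d)) / 2)"
      using integral_kernel_bound[OF pb, of f "deriv f" M "a + c * d"] deriv bound ap
      unfolding eqs abs by auto
    also have "(1 - c) * d * ((1 - c) * d) - (s - c) * d * (\<bar>s - c\<bar> * d)
        = d\<^sup>2 * ((1 - c)\<^sup>2 - (s - c) * \<bar>s - c\<bar>)"
      by (simp add: power2_eq_square algebra_simps)
    also have "(1 - c) * d * f b - (s - c) * d * f p = (1 - c) * d * f b + (c - s) * d * f p"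
      by (simp add: algebra_simps)
    finally show ?thesis by simp
  qed
  \<comment> \<open>These are the integrals of \<open>\<bar>t - k\<bar>\<close> over
    \<open>[0, s]\<close> and of \<open>\<bar>t - c\<bar>\<close> over \<open>[s, 1]\<close>; the
    factor \<open>d\<^sup>2\<close> comes from rescaling both the kernel and the variable.\<close>
  define \<gamma> \<upsilon> where "\<gamma> = ((s - k) * \<bar>s - k\<bar> + k\<^sup>2) / 2"
    and "\<upsilon> = ((1 - c)\<^sup>2 - (s - c) * \<bar>s - c\<bar>) / 2"
  have "E * d \<le> M * (d\<^sup>2 * \<gamma>) + M * (d\<^sup>2 * \<upsilon>)"
  proof -
    \<comment> \<open>The two contributions at \<open>p\<close> combine to the required weight,
      \<open>(s - k) + (c - s) = c - k\<close>.\<close>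
    have "E * d = \<bar>((s - k) * d * f p + k * d * f a - integral {a..p} f)
        + ((1 - c) * d * f b + (c - s) * d * f p - integral {p..b} f)\<bar>"
      unfolding E split by (simp add: algebra_simps)
    then show ?thesis
      using left right unfolding \<gamma>_def \<upsilon>_def by linarith
  qed
  also have "\<dots> = (d * (\<gamma> + \<upsilon>) * M) * d"
    by (simp add: algebra_simps power2_eq_square)
  finally have main: "E \<le> d * (\<gamma> + \<upsilon>) * M"
    using d mult_right_le_imp_le by blast
  \<comment> \<open>Here \<open>(s - k) * \<bar>s - k\<bar> = - (s - k)\<^sup>2\<close>, so the
    terms \<open>k\<^sup>2\<close> cancel; for \<open>k \<le> s\<close> they add up to the extra
    \<open>(\<alpha> * lam)\<^sup>2\<close> of \<open>gamma2\<close>.\<close>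
  have \<gamma>1: "\<gamma> = gamma1 \<alpha> lam" if "s \<le> k"
    using that unfolding \<gamma>_def gamma1_def s_def[symmetric] k_def[symmetric]
    by (simp add: abs_if power2_eq_square field_simps)
  have \<gamma>2: "\<gamma> = gamma2 \<alpha> lam" if "k \<le> s"
    using that unfolding \<gamma>_def gamma2_def gamma1_def s_def[symmetric] k_def[symmetric]
    by (simp add: abs_if power2_eq_square field_simps)
  have \<upsilon>1: "\<upsilon> = upsilon1 \<alpha> lam" if "c \<le> s"
  proof -
    have \<alpha>: "\<alpha> = 1 - s" by (simp add: s_def)
    show ?thesis
      using that unfolding \<upsilon>_def upsilon1_def c_def[symmetric]
      unfolding \<alpha>
      by (simp add: power2_eq_square field_simps)
  qed
  have \<upsilon>2: "\<upsilon> = upsilon2 \<alpha> lam" if "s \<le> c"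
  proof -
    \<comment> \<open>Since \<open>lam * s = 1 - c\<close>, this eliminates \<open>lam\<close> and
      leaves a polynomial identity in \<open>s\<close> and \<open>c\<close>.\<close>
    have eq: "(lam + 1) * (1 - \<alpha>) = 1 - c + s"
      by (simp add: s_def c_def algebra_simps)
    show ?thesis
      using that unfolding \<upsilon>_def upsilon2_def eq
      unfolding c_def[symmetric] unfolding s_def[symmetric]
      by (simp add: abs_if power2_eq_square field_simps)
  qed
  \<comment> \<open>Each case fixes the order of \<open>s\<close> relative to \<open>k\<close> and
    to \<open>c\<close>, which selects the closed forms of \<open>\<gamma>\<close> and
    \<open>\<upsilon>\<close>.\<close>
  show ?thesis
    unfolding M_def[symmetric] d_def[symmetric] c_def[symmetric] k_def[symmetric]
    unfolding s_def[symmetric] using main \<gamma>1 \<gamma>2 \<upsilon>1 \<upsilon>2 by auto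
qed

end
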